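(* Let $n$ and $k$ be integers with $1 \leq k \leq n-3$. Then the following hold. (a) If $n-k$ is even, let $\widehat{G} = K_{k}\vee\big(\overline{K_{\frac{n-k}{2}}}\vee \overline{K_{\frac{n-k}{2}}}\big)$. Then $\widehat{G} \in \Sigma_k(n)$, and $\rho(A_{\widehat{G}})\geq \rho(A_G)$ holds for all graphs $G\in \Sigma_k(n)$, with equality if and only if $G \cong \widehat{G}$. Moreover, $$\rho(A_{\widehat{G}})=\frac{n+k-2+\sqrt{-7k^2+10kn-12k+n^2+4n+4}}{4}.$$ (b) If $n-k$ is odd, let $\widehat{G} = K_{k}\vee\big(\overline{K_{\lfloor\frac{n-k}{2}\rfloor}}\vee \overline{K_{\lfloor\frac{n-k+1}{2}\rfloor}}\big)$. Then $\widehat{G}\in \Sigma_k(n)$, and $\rho(A_{\widehat{G}})\geq \rho(A_G)$ holds for all graphs $G\in \Sigma_k(n)$, with equality if and only if $G \cong \widehat{G}$. Moreover, with $s=\lfloor\frac{n-k}{2}\rfloor$, the number $\rho(A_{\widehat{G}})$ is the maximal eigenvalue of the matrix $$\widetilde{\Upsilon}= \begin{pmatrix} k-1 & s+1 & s \\ k & 0 & s \\ k & s+1 & 0 \end{pmatrix}.$$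
   Context: All graphs are finite, undirected, connected and simple, except that auxiliary graphs used as building blocks (such as complements of complete graphs) may be disconnected. For a graph $G$ with vertices $1,\dots,n$, the adjacency matrix $A_G$ is the $n\times n$ matrix whose $(i,j)$-entry is $1$ if $i$ and $j$ are adjacent and $0$ otherwise. For a square matrix $M$ with spectrum $\sigma(M)$, the spectral radius is $\rho(M)=\max\{|\lambda| : \lambda\in\sigma(M)\}$. $K_m$ is the complete graph on $m$ vertices, and $\overline{G}$ is the complement of $G$ (so $\overline{K_m}$ is the graph on $m$ vertices with no edges). For vertex-disjoint graphs $G_1,G_2$, the join $G_1\vee G_2$ is the graph with vertex set $V(G_1)\cup V(G_2)$ and edge set $E(G_1)\cup E(G_2)\cup\{uv : u\in V(G_1), v\in V(G_2)\}$. The vertex bipartiteness $v_b(G)$ of a graph $G$ is the fewest number of vertices whose deletion from $G$ yields a bipartite graph. For a natural number $k$ with $3\leq n-k$, $$\Sigma_k(n)=\{G=(V(G),E(G)) : G \text{ is connected}, |V(G)|=n \text{ and } v_b(G)\leq k\}.$$ *)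

theory Defs
  imports "Graph_Theory.Graph_Theory" "Jordan_Normal_Form.Spectral_Radius"
begin

text \<open>
  Finite simple graphs are rendered, as in the \<open>Graph_Theory\<close> library, by symmetric loop-free arc
  relations (locale \<open>pair_graph\<close>), with connectedness \<open>Digraph_Component.connected\<close> and isomorphism
  \<open>digraph_iso\<close> of the underlying digraphs.
\<close>

definition complete_graph :: "nat \<Rightarrow> nat pair_pre_digraph" where
  "complete_graph m = \<lparr> pverts = {..<m}, parcs = {(u, v). u < m \<and> v < m \<and> u \<noteq> v} \<rparr>"

lemma complete_digraph_complete_graph: "complete_digraph m (with_proj (complete_graph m))"
  unfolding complete_digraph_pair_def by (auto simp: complete_graph_def)

definition graph_complement :: "'a pair_pre_digraph \<Rightarrow> 'a pair_pre_digraph" where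
  "graph_complement G = \<lparr> pverts = pverts G,
     parcs = {(u, v). u \<in> pverts G \<and> v \<in> pverts G \<and> u \<noteq> v \<and> (u, v) \<notin> parcs G} \<rparr>"

text \<open>The sum type makes the vertex sets of the two joined graphs disjoint.\<close>

definition graph_join ::
  "'a pair_pre_digraph \<Rightarrow> 'b pair_pre_digraph \<Rightarrow> ('a + 'b) pair_pre_digraph" where
  "graph_join G H = \<lparr> pverts = Inl ` pverts G \<union> Inr ` pverts H,
     parcs = {(Inl u, Inl v) | u v. (u, v) \<in> parcs G}
           \<union> {(Inr u, Inr v) | u v. (u, v) \<in> parcs H}
           \<union> {(Inl u, Inr v) | u v. u \<in> pverts G \<and> v \<in> pverts H}
           \<union> {(Inr v, Inl u) | u v. u \<in> pverts G \<and> v \<in> pverts H} \<rparr>"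

definition delete_verts :: "'a pair_pre_digraph \<Rightarrow> 'a set \<Rightarrow> 'a pair_pre_digraph" where
  "delete_verts G S = \<lparr> pverts = pverts G - S,
     parcs = {(u, v). (u, v) \<in> parcs G \<and> u \<notin> S \<and> v \<notin> S} \<rparr>"

text \<open>Either part may be empty, so that edgeless graphs (also the empty one) are bipartite.\<close>

definition bipartite :: "'a pair_pre_digraph \<Rightarrow> bool" where
  "bipartite G \<longleftrightarrow> (\<exists>X Y. X \<union> Y = pverts G \<and> X \<inter> Y = {} \<and> parcs G \<subseteq> X \<times> Y \<union> Y \<times> X)"

definition vertex_bipartiteness :: "'a pair_pre_digraph \<Rightarrow> nat" where
  "vertex_bipartiteness G =
     (LEAST m. \<exists>S. S \<subseteq> pverts G \<and> card S = m \<and> bipartite (delete_verts G S))"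

definition Sigma_class :: "nat \<Rightarrow> nat \<Rightarrow> 'a pair_pre_digraph set" where
  "Sigma_class k n = {G. pair_graph G \<and> Digraph_Component.connected (with_proj G) \<and>
     card (pverts G) = n \<and> vertex_bipartiteness G \<le> k}"

text \<open>
  The adjacency matrix depends on a numbering of the vertices. For a graph with arbitrary vertices
  we fix one by choice; its spectrum, hence its spectral radius, does not depend on that choice, see
  \<open>spectrum_adjacency_matrix\<close> below. The entries are complex because \<open>spectral_radius\<close> is
  defined for complex matrices.
\<close>

definition adjacency_matrix_wrt :: "'a list \<Rightarrow> 'a pair_pre_digraph \<Rightarrow> complex mat" where
  "adjacency_matrix_wrt vs G = mat (length vs) (length vs)
     (\<lambda>(i, j). if (vs ! i, vs ! j) \<in> parcs G then 1 else 0)"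

definition adjacency_matrix :: "'a pair_pre_digraph \<Rightarrow> complex mat" where
  "adjacency_matrix G =
     adjacency_matrix_wrt (SOME vs. distinct vs \<and> set vs = pverts G) G"

lemma spectrum_adjacency_matrix_wrt_mono:
  assumes "distinct vs" "distinct ws" "set vs = set ws"
  shows "spectrum (adjacency_matrix_wrt vs G) \<subseteq> spectrum (adjacency_matrix_wrt ws G)"
proof
  fix c assume "c \<in> spectrum (adjacency_matrix_wrt vs G)"
  then obtain x where x: "eigenvector (adjacency_matrix_wrt vs G) x c"
    by (auto simp: spectrum_def eigenvalue_def)
  define n where "n = length vs"
  have n': "length ws = n" using assms by (metis n_def distinct_card)
  define p where "p = (\<lambda>i. THE j. j < n \<and> vs ! j = ws ! i)"
  have p: "p i < n \<and> vs ! p i = ws ! i" if "i < n" for i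
  proof -
    have "\<exists>!j. j < n \<and> vs ! j = ws ! i"
      using assms that n' unfolding n_def
      by (metis in_set_conv_nth nth_eq_iff_index_eq)
    then show ?thesis unfolding p_def by (rule theI')
  qed
  have inj: "inj_on p {0..<n}"
  proof (rule inj_onI)
    fix i j assume "i \<in> {0..<n}" "j \<in> {0..<n}" "p i = p j"
    then show "i = j" using p[of i] p[of j] assms(2) n'
      by (metis atLeastLessThan_iff nth_eq_iff_index_eq)
  qed
  have bij: "bij_betw p {0..<n} {0..<n}"
    unfolding bij_betw_def using inj p by (intro conjI endo_inj_surj) auto
  have xd: "x \<in> carrier_vec n" "x \<noteq> 0\<^sub>v n"
    and xe: "adjacency_matrix_wrt vs G *\<^sub>v x = c \<cdot>\<^sub>v x"
    using x by (auto simp: eigenvector_def adjacency_matrix_wrt_def n_def)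
  have row: "(\<Sum>j\<in>{0..<n}. (if (vs ! i, vs ! j) \<in> parcs G then 1 else 0) * x $ j) = c * x $ i"
    if "i < n" for i
  proof -
    have "(adjacency_matrix_wrt vs G *\<^sub>v x) $ i = (c \<cdot>\<^sub>v x) $ i" by (simp add: xe)
    then show ?thesis using that xd(1)
      by (simp add: adjacency_matrix_wrt_def scalar_prod_def n_def)
  qed
  define y where "y = vec n (\<lambda>i. x $ p i)"
  have "y \<noteq> 0\<^sub>v n"
  proof
    assume y0: "y = 0\<^sub>v n"
    have "x = 0\<^sub>v n"
    proof (rule eq_vecI)
      fix i assume "i < dim_vec (0\<^sub>v n :: complex vec)"
      then have i: "i < n" by simp
      then obtain j where j: "j < n" "p j = i" using bij
        by (metis atLeastLessThan_iff bij_betw_imp_surj_on imageE zero_le)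
      have "y $ j = 0" using y0 j by simp
      then show "x $ i = 0\<^sub>v n $ i" using j i by (simp add: y_def)
    qed (use xd in auto)
    with xd show False by simp
  qed
  moreover have "adjacency_matrix_wrt ws G *\<^sub>v y = c \<cdot>\<^sub>v y"
  proof (rule eq_vecI)
    fix i assume "i < dim_vec (c \<cdot>\<^sub>v y)"
    then have i: "i < n" by (simp add: y_def)
    have "(adjacency_matrix_wrt ws G *\<^sub>v y) $ i =
        (\<Sum>j\<in>{0..<n}. (if (ws ! i, ws ! j) \<in> parcs G then 1 else 0) * x $ p j)"
      using i n' by (simp add: adjacency_matrix_wrt_def scalar_prod_def y_def)
    also have "\<dots> = (\<Sum>j\<in>{0..<n}. (if (vs ! p i, vs ! p j) \<in> parcs G then 1 else 0) * x $ p j)"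
      using p i by (intro sum.cong) auto
    also have "\<dots> = (\<Sum>j\<in>{0..<n}. (if (vs ! p i, vs ! j) \<in> parcs G then 1 else 0) * x $ j)"
      by (rule sum.reindex_bij_betw[OF bij,
          of "\<lambda>j. (if (vs ! p i, vs ! j) \<in> parcs G then 1 else 0) * x $ j"])
    also have "\<dots> = c * x $ p i" using row p i by blast
    finally show "(adjacency_matrix_wrt ws G *\<^sub>v y) $ i = (c \<cdot>\<^sub>v y) $ i"
      using i by (simp add: y_def)
  qed (simp add: adjacency_matrix_wrt_def y_def n')
  ultimately have "eigenvector (adjacency_matrix_wrt ws G) y c"
    by (simp add: eigenvector_def adjacency_matrix_wrt_def n' y_def)
  then show "c \<in> spectrum (adjacency_matrix_wrt ws G)"
    by (auto simp: spectrum_def eigenvalue_def)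
qed

lemma spectrum_adjacency_matrix:
  assumes "distinct vs" "set vs = pverts G"
  shows "spectrum (adjacency_matrix G) = spectrum (adjacency_matrix_wrt vs G)"
proof -
  define ws where "ws = (SOME ws. distinct ws \<and> set ws = pverts G)"
  have "distinct ws \<and> set ws = pverts G"
    unfolding ws_def by (rule someI[of _ vs]) (use assms in simp)
  then show ?thesis
    using spectrum_adjacency_matrix_wrt_mono[of vs ws G]
      spectrum_adjacency_matrix_wrt_mono[of ws vs G] assms
    by (auto simp: adjacency_matrix_def ws_def)
qed

end

theory Submission
  imports Defs
begin

text \<open>
  Deleting some set of at most \<open>k\<close> vertices makes a graph of the class bipartite, and deleting
  further vertices keeps it bipartite. So the vertex set splits into \<open>S\<close> with exactly \<open>k\<close> vertices
  and two independent sets \<open>X\<close>, \<open>Y\<close> of sizes \<open>a + b = n - k\<close>; the graph is a spanning subgraph of the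
  join of a complete graph on \<open>S\<close> with the complete bipartite graph on \<open>X\<close>, \<open>Y\<close>. It remains to
  compare all these joins, and their subgraphs, with the balanced one.
  
  The full join with part sizes \<open>k\<close>, \<open>a\<close>, \<open>b\<close> has spectral radius \<open>\<rho>\<close> as soon as \<open>\<rho> > 0\<close> and
  \<open>k / (\<rho> + 1) + a / (\<rho> + a) + b / (\<rho> + b) = 1\<close>. Call the left-hand side the load at \<open>\<rho>\<close>. The function
  \<open>z\<close> that is \<open>1\<close> on \<open>S\<close>, \<open>(\<rho> + 1) / (\<rho> + a)\<close> on \<open>X\<close> and \<open>(\<rho> + 1) / (\<rho> + b)\<close> on \<open>Y\<close> satisfies
  \<open>A z = \<rho> z - (\<rho> + 1) (1 - load)\<close> at every vertex, where \<open>A\<close> is the adjacency operator of the join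
  (\<open>test_weight_neighbour_sum\<close>).
  
  Fix \<open>\<rho>\<close> to be the value for the balanced sizes. Since \<open>a / (\<rho> + a)\<close> is strictly concave in \<open>a\<close>, any
  other sizes with the same sum (up to order) have load below \<open>1\<close> (\<open>load_balanced\<close>). Hence for every graph of the
  class the positive function \<open>z\<close> built from its own parts satisfies \<open>A z \<le> \<rho> z\<close>: removing edges only
  lowers \<open>A z\<close>. Pairing \<open>z\<close> with the absolute values of an eigenvector and using that \<open>A\<close> is symmetric,
  this bounds every eigenvalue by \<open>\<rho>\<close> (\<open>supersolution_bounds_eigenvalues\<close>). If the bound is attained by
  a connected graph, the absolute values of the eigenvector vanish nowhere, so \<open>A z = \<rho> z\<close> everywhere
  (\<open>supersolution_tight\<close>). Then no edge of the join is missing and the load is exactly \<open>1\<close>, so the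
  sizes are balanced and the graph is the extremal one up to isomorphism.
  
  With equal parts the equation for \<open>\<rho>\<close> is quadratic, which gives the closed formula. With parts of
  sizes \<open>s\<close> and \<open>s + 1\<close> the matrix in the theorem is the quotient matrix of the partition: the three values
  of \<open>z\<close> form an eigenvector of it for \<open>\<rho>\<close>, and each of its eigenvectors lifts to one of the graph.
\<close>

section \<open>Adjacency eigenvalues as functions on the vertices\<close>

definition nbrs :: "'a pair_pre_digraph \<Rightarrow> 'a \<Rightarrow> 'a set" where
  "nbrs G v = {w \<in> pverts G. (v, w) \<in> parcs G}"

lemma finite_nbrs: "finite (pverts G) \<Longrightarrow> finite (nbrs G v)"
  by (simp add: nbrs_def)

text \<open>
  Frees all later arguments from the numbering of the vertices: an eigenvector becomes a function
  on the vertices, and the adjacency operator sums it over neighbours.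
\<close>

lemma adjacency_spectrum_iff:
  assumes "finite (pverts G)"
  shows "c \<in> spectrum (adjacency_matrix G) \<longleftrightarrow>
    (\<exists>u. (\<exists>v \<in> pverts G. u v \<noteq> 0) \<and> (\<forall>v \<in> pverts G. (\<Sum>w\<in>nbrs G v. u w) = c * u v))"
    (is "_ \<longleftrightarrow> ?R")
proof -
  obtain vs where vs: "distinct vs" "set vs = pverts G"
    using finite_distinct_list[OF assms] by auto
  define N where "N = length vs"
  let ?A = "adjacency_matrix_wrt vs G"
  have bij: "bij_betw (\<lambda>i. vs ! i) {0..<N} (pverts G)"
    using vs by (simp add: N_def bij_betw_nth atLeast0LessThan)
  have A: "?A \<in> carrier_mat N N" by (simp add: adjacency_matrix_wrt_def N_def)
  have row: "(?A *\<^sub>v vec N (\<lambda>i. u (vs ! i))) $ i = (\<Sum>w\<in>nbrs G (vs ! i). u w)"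
    if "i < N" for i and u :: "'a \<Rightarrow> complex"
  proof -
    have "(?A *\<^sub>v vec N (\<lambda>i. u (vs ! i))) $ i =
        (\<Sum>j\<in>{0..<N}. if (vs ! i, vs ! j) \<in> parcs G then u (vs ! j) else 0)"
      using that by (auto simp: adjacency_matrix_wrt_def N_def scalar_prod_def intro!: sum.cong)
    also have "\<dots> = (\<Sum>w\<in>pverts G. if (vs ! i, w) \<in> parcs G then u w else 0)"
      by (rule sum.reindex_bij_betw[OF bij, of "\<lambda>w. if (vs ! i, w) \<in> parcs G then u w else 0"])
    also have "\<dots> = (\<Sum>w\<in>nbrs G (vs ! i). u w)"
      unfolding nbrs_def by (rule sum.inter_filter[OF assms, symmetric])
    finally show ?thesis .
  qed
  have mem: "vs ! i \<in> pverts G" if "i < N" for i using nth_mem[of i vs] that unfolding N_def vs(2) .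
  have idx: "\<exists>i<N. v = vs ! i" if "v \<in> pverts G" for v
    using that unfolding vs(2)[symmetric] N_def in_set_conv_nth by fastforce
  have "c \<in> spectrum ?A \<longleftrightarrow> (\<exists>x. eigenvector ?A x c)"
    by (auto simp: spectrum_def eigenvalue_def)
  also have "\<dots> \<longleftrightarrow> ?R"
  proof
    assume "\<exists>x. eigenvector ?A x c"
    then obtain x where x: "x \<in> carrier_vec N" "x \<noteq> 0\<^sub>v N" "?A *\<^sub>v x = c \<cdot>\<^sub>v x"
      using A by (auto simp: eigenvector_def)
    define u where "u v = x $ (THE i. i < N \<and> vs ! i = v)" for v
    have u: "u (vs ! i) = x $ i" if "i < N" for i
    proof -
      have "(THE j. j < N \<and> vs ! j = vs ! i) = i"
        using that vs(1) by (intro the_equality) (auto simp: N_def nth_eq_iff_index_eq)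
      then show ?thesis by (simp add: u_def)
    qed
    have xu: "x = vec N (\<lambda>i. u (vs ! i))" using x(1) u by (intro eq_vecI) auto
    obtain i where i: "i < N" "x $ i \<noteq> 0"
      using x(1,2) by (metis carrier_vecD eq_vecI index_zero_vec(1) zero_carrier_vec)
    have "\<exists>v \<in> pverts G. u v \<noteq> 0" using i u mem by metis
    moreover have "(\<Sum>w\<in>nbrs G v. u w) = c * u v" if v: "v \<in> pverts G" for v
    proof -
      obtain i where i: "i < N" "v = vs ! i" using idx[OF v] by blast
      have "(?A *\<^sub>v x) $ i = c * x $ i" using x i by simp
      then show ?thesis using row[OF i(1), of u] xu u i by metis
    qed
    ultimately show ?R by blast
  next
    assume ?R
    then obtain u where u: "\<exists>v \<in> pverts G. u v \<noteq> 0"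
      "\<And>v. v \<in> pverts G \<Longrightarrow> (\<Sum>w\<in>nbrs G v. u w) = c * u v" by blast
    let ?x = "vec N (\<lambda>i. u (vs ! i))"
    have "?x \<noteq> 0\<^sub>v N"
    proof
      assume "?x = 0\<^sub>v N"
      then have "u (vs ! i) = 0" if "i < N" for i using that by (metis index_vec index_zero_vec(1))
      then show False using u(1) idx by metis
    qed
    moreover have "?A *\<^sub>v ?x = c \<cdot>\<^sub>v ?x"
    proof (rule eq_vecI)
      fix i assume "i < dim_vec (c \<cdot>\<^sub>v ?x)"
      then show "(?A *\<^sub>v ?x) $ i = (c \<cdot>\<^sub>v ?x) $ i" using row[of i u] u(2) mem by simp
    qed (use A in simp)
    ultimately have "eigenvector ?A ?x c" using A by (simp add: eigenvector_def)
    then show "\<exists>x. eigenvector ?A x c" by blast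
  qed
  finally show ?thesis using spectrum_adjacency_matrix[OF vs] by simp
qed

lemma
  assumes "finite (pverts G)" "pverts G \<noteq> {}"
  shows spectral_radius_attained:
      "\<exists>c \<in> spectrum (adjacency_matrix G). norm c = spectral_radius (adjacency_matrix G)"
    and norm_le_spectral_radius:
      "c \<in> spectrum (adjacency_matrix G) \<Longrightarrow> norm c \<le> spectral_radius (adjacency_matrix G)"
proof -
  define vs where "vs = (SOME vs. distinct vs \<and> set vs = pverts G)"
  have "distinct vs \<and> set vs = pverts G"
    unfolding vs_def by (rule someI_ex) (use finite_distinct_list[OF assms(1)] in auto)
  then have "length vs \<noteq> 0" using assms(2) by auto
  moreover have "adjacency_matrix G \<in> carrier_mat (length vs) (length vs)"
    by (simp add: adjacency_matrix_def adjacency_matrix_wrt_def vs_def)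
  ultimately show "\<exists>c \<in> spectrum (adjacency_matrix G). norm c = spectral_radius (adjacency_matrix G)"
    "c \<in> spectrum (adjacency_matrix G) \<Longrightarrow> norm c \<le> spectral_radius (adjacency_matrix G)"
    using spectral_radius_mem_max[of "adjacency_matrix G" "length vs"] by auto
qed

section \<open>Bounding the spectral radius by a positive supersolution\<close>

lemma connected_closed_set:
  assumes "Digraph_Component.connected (with_proj G)" "v \<in> pverts G" "P v"
    and "\<And>v w. (v, w) \<in> parcs G \<or> (w, v) \<in> parcs G \<Longrightarrow> P v \<Longrightarrow> P w"
    and "w \<in> pverts G"
  shows "P w"
proof -
  have "v \<rightarrow>\<^sup>*\<^bsub>with_proj (mk_symmetric (with_proj G))\<^esub> w"
    using assms(1,2,5)
    by (auto simp: Digraph_Component.connected_def strongly_connected_def mk_symmetric_def)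
  then have "(v, w) \<in> rtrancl_on (pverts (mk_symmetric (with_proj G))) (parcs (mk_symmetric (with_proj G)))"
    by (simp add: reachable_def)
  then show ?thesis
  proof (induction rule: rtrancl_on_induct)
    case base then show ?case using assms(3) by simp
  next
    case (step y z)
    then show ?case using assms(4)[of y z] by (auto simp: mk_symmetric_def)
  qed
qed

text \<open>
  A weak form of Perron-Frobenius theory that suffices here. Let \<open>u\<close> be an eigenvector for \<open>c\<close> and
  \<open>h = |u|\<close>; the triangle inequality gives \<open>|c| h \<le> A h\<close>. Taking inner products with \<open>z\<close> and moving \<open>A\<close>
  to the other side by symmetry gives \<open>|c| (z, h) \<le> (A z, h) \<le> \<rho> (z, h)\<close>. If \<open>|c| = \<rho>\<close>, both
  inequalities are equalities at every vertex. Then \<open>A h = \<rho> h\<close>, so the zero set of \<open>h\<close> is closed under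
  adjacency, hence empty by connectedness, and dividing the second equality by \<open>h\<close> gives \<open>A z = \<rho> z\<close>.
\<close>

lemma
  fixes z :: "'a \<Rightarrow> real"
  assumes G: "pair_graph G"
    and pos: "\<And>v. v \<in> pverts G \<Longrightarrow> z v > 0"
    and super: "\<And>v. v \<in> pverts G \<Longrightarrow> (\<Sum>w\<in>nbrs G v. z w) \<le> \<rho> * z v"
    and c: "c \<in> spectrum (adjacency_matrix G)"
  shows supersolution_bounds_eigenvalues: "norm c \<le> \<rho>"
    and supersolution_tight:
      "\<lbrakk>norm c = \<rho>; Digraph_Component.connected (with_proj G); v \<in> pverts G\<rbrakk>
        \<Longrightarrow> (\<Sum>w\<in>nbrs G v. z w) = \<rho> * z v"
proof -
  interpret pair_graph G by fact
  let ?V = "pverts G"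
  have fin: "finite ?V" by (rule pair_finite_verts)
  obtain u where u0: "\<exists>v \<in> ?V. u v \<noteq> 0"
    and u: "\<And>v. v \<in> ?V \<Longrightarrow> (\<Sum>w\<in>nbrs G v. u w) = c * u v"
    using c unfolding adjacency_spectrum_iff[OF fin] by blast
  define h where "h v = norm (u v)" for v
  have h0: "h v \<ge> 0" for v by (simp add: h_def)
  have sub: "norm c * h v \<le> (\<Sum>w\<in>nbrs G v. h w)" if "v \<in> ?V" for v
  proof -
    have "norm c * h v = norm (\<Sum>w\<in>nbrs G v. u w)"
      using u[OF that] by (simp add: h_def norm_mult)
    also have "\<dots> \<le> (\<Sum>w\<in>nbrs G v. h w)" unfolding h_def by (rule norm_sum)
    finally show ?thesis .
  qed
  have swap: "(\<Sum>v\<in>?V. z v * (\<Sum>w\<in>nbrs G v. h w)) = (\<Sum>v\<in>?V. h v * (\<Sum>w\<in>nbrs G v. z w))"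
  proof -
    have "(\<Sum>v\<in>?V. z v * (\<Sum>w\<in>nbrs G v. h w)) =
        (\<Sum>v\<in>?V. \<Sum>w\<in>?V. if (v, w) \<in> parcs G then z v * h w else 0)"
      unfolding nbrs_def sum.inter_filter[OF fin] sum_distrib_left
      by (intro sum.cong refl) auto
    also have "\<dots> = (\<Sum>w\<in>?V. \<Sum>v\<in>?V. if (v, w) \<in> parcs G then z v * h w else 0)"
      by (rule sum.swap)
    also have "\<dots> = (\<Sum>v\<in>?V. h v * (\<Sum>w\<in>nbrs G v. z w))"
      unfolding nbrs_def sum.inter_filter[OF fin] sum_distrib_left
      by (intro sum.cong refl) (auto dest: arcs_symmetric)
    finally show ?thesis .
  qed
  \<comment> \<open>the total slack at \<open>v\<close> of the two inequalities, weighted to sum to \<open>(\<rho> - |c|) * (z, h)\<close>\<close>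
  define d where "d v = z v * ((\<Sum>w\<in>nbrs G v. h w) - norm c * h v)
     + h v * (\<rho> * z v - (\<Sum>w\<in>nbrs G v. z w))" for v
  have d1: "0 \<le> z v * ((\<Sum>w\<in>nbrs G v. h w) - norm c * h v)"
    and d2: "0 \<le> h v * (\<rho> * z v - (\<Sum>w\<in>nbrs G v. z w))" if "v \<in> ?V" for v
    using sub[OF that] super[OF that] pos[OF that] h0[of v] by auto
  have "(\<Sum>v\<in>?V. d v) = (\<Sum>v\<in>?V. z v * (\<Sum>w\<in>nbrs G v. h w)) - (\<Sum>v\<in>?V. h v * (\<Sum>w\<in>nbrs G v. z w))
     + (\<Sum>v\<in>?V. (\<rho> - norm c) * (z v * h v))"
    unfolding d_def sum_subtractf[symmetric] sum.distrib[symmetric]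
    by (intro sum.cong refl) (simp add: algebra_simps)
  then have total: "(\<Sum>v\<in>?V. d v) = (\<rho> - norm c) * (\<Sum>v\<in>?V. z v * h v)"
    unfolding swap sum_distrib_left[symmetric] by simp
  have mass: "(\<Sum>v\<in>?V. z v * h v) > 0"
  proof -
    obtain v where v: "v \<in> ?V" "u v \<noteq> 0" using u0 by blast
    show ?thesis
      by (rule sum_pos2[OF fin v(1)]) (use v pos h0 in \<open>auto simp: h_def less_imp_le\<close>)
  qed
  have dnn: "0 \<le> d v" if "v \<in> ?V" for v using d1[OF that] d2[OF that] by (simp add: d_def)
  have "0 \<le> (\<rho> - norm c) * (\<Sum>v\<in>?V. z v * h v)"
    unfolding total[symmetric] by (rule sum_nonneg) (rule dnn)
  with mass show "norm c \<le> \<rho>" by (simp add: zero_le_mult_iff)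
  assume eq: "norm c = \<rho>" and conn: "Digraph_Component.connected (with_proj G)" and v: "v \<in> ?V"
  have "(\<Sum>v\<in>?V. d v) = 0" using total eq by simp
  then have "\<forall>v\<in>?V. d v = 0" using sum_nonneg_eq_0_iff[OF fin, of d] dnn by blast
  then have e1: "z v * ((\<Sum>w\<in>nbrs G v. h w) - norm c * h v) = 0"
    and e2: "h v * (\<rho> * z v - (\<Sum>w\<in>nbrs G v. z w)) = 0" if "v \<in> ?V" for v
    using d1[OF that] d2[OF that] that unfolding d_def by (force simp: add_nonneg_eq_0_iff)+
  have "h v \<noteq> 0"
  proof
    assume hv: "h v = 0"
    have step: "h y = 0" if "(x, y) \<in> parcs G \<or> (y, x) \<in> parcs G" "h x = 0" for x y
    proof -
      have xy: "(x, y) \<in> parcs G" using that(1) arcs_symmetric by blast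
      then have "x \<in> ?V" "y \<in> nbrs G x" using wellformed' by (auto simp: nbrs_def)
      then have "(\<Sum>w\<in>nbrs G x. h w) = 0" "y \<in> nbrs G x"
        using e1[of x] pos[of x] that(2) by auto
      then show ?thesis using sum_nonneg_eq_0_iff[OF finite_nbrs[OF fin], of x h] h0 by auto
    qed
    have "h w = 0" if "w \<in> ?V" for w
      by (rule connected_closed_set[OF conn v, of "\<lambda>w. h w = 0"]) (use hv step that in auto)
    then show False using u0 by (auto simp: h_def)
  qed
  then show "(\<Sum>w\<in>nbrs G v. z w) = \<rho> * z v" using e2[OF v] by simp
qed

section \<open>Joins of a complete graph with a complete bipartite graph\<close>

definition join_arcs :: "'a set \<Rightarrow> 'a set \<Rightarrow> 'a set \<Rightarrow> 'a rel" where
  "join_arcs S X Y =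
     {(u, v). u \<in> S \<union> X \<union> Y \<and> v \<in> S \<union> X \<union> Y \<and> u \<noteq> v} - X \<times> X - Y \<times> Y"

definition partitions :: "'a set \<Rightarrow> 'a set \<Rightarrow> 'a set \<Rightarrow> 'a set \<Rightarrow> bool" where
  "partitions V S X Y \<longleftrightarrow> V = S \<union> X \<union> Y \<and> S \<inter> X = {} \<and> S \<inter> Y = {} \<and> X \<inter> Y = {}"

definition weight :: "'a set \<Rightarrow> 'a set \<Rightarrow> 'b \<Rightarrow> 'b \<Rightarrow> 'b \<Rightarrow> 'a \<Rightarrow> 'b" where
  "weight S X p q r v = (if v \<in> S then p else if v \<in> X then q else r)"

lemma join_neighbour_sum:
  fixes p q r :: real
  assumes V: "partitions V S X Y" and fin: "finite V"
  shows "v \<in> S \<Longrightarrow> (\<Sum>w | (v, w) \<in> join_arcs S X Y. weight S X p q r w) =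
      (real (card S) - 1) * p + real (card X) * q + real (card Y) * r"
    and "v \<in> X \<Longrightarrow> (\<Sum>w | (v, w) \<in> join_arcs S X Y. weight S X p q r w) =
      real (card S) * p + real (card Y) * r"
    and "v \<in> Y \<Longrightarrow> (\<Sum>w | (v, w) \<in> join_arcs S X Y. weight S X p q r w) =
      real (card S) * p + real (card X) * q"
proof -
  let ?f = "weight S X p q r"
  have fins: "finite S" "finite X" "finite Y"
    using V fin by (auto simp: partitions_def)
  have sums: "sum ?f T = real (card T) * p" if "T \<subseteq> S" for T
  proof -
    have "sum ?f T = sum (\<lambda>_. p) T" using that by (intro sum.cong) (auto simp: weight_def)
    then show ?thesis by simp
  qed
  have sumX: "sum ?f X = real (card X) * q"
  proof -
    have "sum ?f X = sum (\<lambda>_. q) X"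
      using V by (intro sum.cong) (auto simp: weight_def partitions_def)
    then show ?thesis by simp
  qed
  have sumY: "sum ?f Y = real (card Y) * r"
  proof -
    have "sum ?f Y = sum (\<lambda>_. r) Y"
      using V by (intro sum.cong) (auto simp: weight_def partitions_def)
    then show ?thesis by simp
  qed
  show "sum ?f {w. (v, w) \<in> join_arcs S X Y} =
      (real (card S) - 1) * p + real (card X) * q + real (card Y) * r" if v: "v \<in> S"
  proof -
    have e: "{w. (v, w) \<in> join_arcs S X Y} = ((S - {v}) \<union> X) \<union> Y"
      using V v by (auto simp: join_arcs_def partitions_def)
    have "sum ?f {w. (v, w) \<in> join_arcs S X Y} = sum ?f (S - {v}) + sum ?f X + sum ?f Y"
      unfolding e using V fins
      by (subst sum.union_disjoint; (subst sum.union_disjoint)?) (auto simp: partitions_def)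
    moreover have "real (card (S - {v})) = real (card S) - 1"
      using v fins by (metis One_nat_def Suc_pred card_Diff_singleton card_gt_0_iff diff_Suc_1 empty_iff of_nat_Suc add_diff_cancel_left')
    ultimately show ?thesis using sums[of "S - {v}"] sumX sumY by auto
  qed
  show "sum ?f {w. (v, w) \<in> join_arcs S X Y} = real (card S) * p + real (card Y) * r"
    if v: "v \<in> X"
  proof -
    have e: "{w. (v, w) \<in> join_arcs S X Y} = S \<union> Y"
      using V v by (auto simp: join_arcs_def partitions_def)
    show ?thesis unfolding e using V fins sums[of S] sumY
      by (subst sum.union_disjoint) (auto simp: partitions_def)
  qed
  show "sum ?f {w. (v, w) \<in> join_arcs S X Y} = real (card S) * p + real (card X) * q"
    if v: "v \<in> Y"
  proof -
    have e: "{w. (v, w) \<in> join_arcs S X Y} = S \<union> X"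
      using V v by (auto simp: join_arcs_def partitions_def)
    show ?thesis unfolding e using V fins sums[of S] sumX
      by (subst sum.union_disjoint) (auto simp: partitions_def)
  qed
qed

text \<open>
  Normalise an eigenvector for \<open>\<rho>\<close> of the join with part sizes \<open>k\<close>, \<open>a\<close>, \<open>b\<close> to have total mass \<open>1\<close>. A vertex
  of \<open>S\<close> with value \<open>p\<close> satisfies \<open>\<rho> p = 1 - p\<close>, and one of \<open>X\<close> with value \<open>q\<close> satisfies \<open>\<rho> q = 1 - a q\<close>.
  The three terms are the resulting masses of the parts, so the load must be \<open>1\<close>.
\<close>

definition load :: "nat \<Rightarrow> nat \<Rightarrow> nat \<Rightarrow> real \<Rightarrow> real" where
  "load k a b \<rho> = real k / (\<rho> + 1) + real a / (\<rho> + real a) + real b / (\<rho> + real b)"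

text \<open>
  The eigenvector just described, rescaled to take the value \<open>1\<close> on \<open>S\<close>. It is meaningful for every
  \<open>\<rho> > 0\<close>, not only for an eigenvalue.
\<close>

definition test_weight :: "'a set \<Rightarrow> 'a set \<Rightarrow> 'a set \<Rightarrow> real \<Rightarrow> 'a \<Rightarrow> real" where
  "test_weight S X Y \<rho> =
     weight S X 1 ((\<rho> + 1) / (\<rho> + real (card X))) ((\<rho> + 1) / (\<rho> + real (card Y)))"

lemma test_weight_pos: "\<rho> > 0 \<Longrightarrow> test_weight S X Y \<rho> v > 0"
  by (auto simp: test_weight_def weight_def intro!: divide_pos_pos add_pos_nonneg)

text \<open>
  The defect from being an eigenvector is the same constant at every vertex, and its sign is
  governed by whether the load exceeds \<open>1\<close>.
\<close>

lemma test_weight_neighbour_sum: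
  assumes V: "partitions V S X Y" and fin: "finite V" and \<rho>: "\<rho> > 0" and v: "v \<in> V"
  shows "(\<Sum>w | (v, w) \<in> join_arcs S X Y. test_weight S X Y \<rho> w) =
    \<rho> * test_weight S X Y \<rho> v - (\<rho> + 1) * (1 - load (card S) (card X) (card Y) \<rho>)"
proof -
  define a b where "a = real (card X)" and "b = real (card Y)"
  have nz: "\<rho> + 1 \<noteq> 0" "\<rho> + a \<noteq> 0" "\<rho> + b \<noteq> 0"
    using \<rho> by (auto simp: a_def b_def add_pos_nonneg intro!: less_imp_neq[symmetric])
  define A B where "A = a / (\<rho> + a)" and "B = b / (\<rho> + b)"
  have A: "\<rho> * ((\<rho> + 1) / (\<rho> + a)) = (\<rho> + 1) * (1 - A)"
    using nz(2) by (simp add: A_def field_simps)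
  have B: "\<rho> * ((\<rho> + 1) / (\<rho> + b)) = (\<rho> + 1) * (1 - B)"
    using nz(3) by (simp add: B_def field_simps)
  have A': "a * ((\<rho> + 1) / (\<rho> + a)) = (\<rho> + 1) * A"
   and B': "b * ((\<rho> + 1) / (\<rho> + b)) = (\<rho> + 1) * B"
    by (simp_all add: A_def B_def)
  have F: "(\<rho> + 1) * (1 - load (card S) (card X) (card Y) \<rho>) =
      \<rho> + 1 - real (card S) - (\<rho> + 1) * A - (\<rho> + 1) * B"
    using nz(1) by (simp add: load_def A_def B_def a_def b_def right_diff_distrib distrib_left)
  consider "v \<in> S" | "v \<in> X" | "v \<in> Y" using V v by (auto simp: partitions_def)
  then show ?thesis
  proof cases
    case 1
    then show ?thesis
      unfolding F test_weight_def using join_neighbour_sum(1)[OF V fin 1] A' B'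
      by (simp add: weight_def a_def b_def)
  next
    case 2
    then have "v \<notin> S" using V by (auto simp: partitions_def)
    then show ?thesis
      unfolding F test_weight_def using join_neighbour_sum(2)[OF V fin 2] A B' 2
      by (simp add: weight_def a_def b_def algebra_simps)
  next
    case 3
    then have "v \<notin> S" "v \<notin> X" using V by (auto simp: partitions_def)
    then show ?thesis
      unfolding F test_weight_def using join_neighbour_sum(3)[OF V fin 3] B A' 3
      by (simp add: weight_def a_def b_def algebra_simps)
  qed
qed

lemma real_eigenfunction:
  fixes u :: "'a \<Rightarrow> real"
  assumes "finite (pverts G)" "v \<in> pverts G" "u v \<noteq> 0"
    and "\<And>v. v \<in> pverts G \<Longrightarrow> (\<Sum>w\<in>nbrs G v. u w) = \<mu> * u v"
  shows "complex_of_real \<mu> \<in> spectrum (adjacency_matrix G)"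
  unfolding adjacency_spectrum_iff[OF assms(1)]
proof (intro exI[of _ "\<lambda>v. complex_of_real (u v)"] conjI ballI)
  show "\<exists>v\<in>pverts G. complex_of_real (u v) \<noteq> 0" using assms(2,3) by auto
  show "(\<Sum>w\<in>nbrs G v. complex_of_real (u w)) = complex_of_real \<mu> * complex_of_real (u v)"
    if "v \<in> pverts G" for v using assms(4)[OF that] by (metis of_real_mult of_real_sum)
qed

lemma nbrs_join_arcs:
  assumes "partitions (pverts G) S X Y" "parcs G = join_arcs S X Y"
  shows "nbrs G v = {w. (v, w) \<in> join_arcs S X Y}"
  using assms by (auto simp: nbrs_def join_arcs_def partitions_def)

text \<open>
  The neighbour sums in \<open>G\<close> are at most those in the join, so the test weight is a supersolution. In the
  equality case both losses must be zero: the one from missing edges, where positivity of the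
  weight forces \<open>G\<close> to be the whole join, and the one from the load.
\<close>

lemma subgraph_of_join_spectral_radius:
  assumes G: "pair_graph G" and ne: "pverts G \<noteq> {}"
    and V: "partitions (pverts G) S X Y" and sub: "parcs G \<subseteq> join_arcs S X Y"
    and \<rho>: "\<rho> > 0" and load: "load (card S) (card X) (card Y) \<rho> \<le> 1"
  shows "spectral_radius (adjacency_matrix G) \<le> \<rho>"
    and "\<lbrakk>spectral_radius (adjacency_matrix G) = \<rho>; Digraph_Component.connected (with_proj G)\<rbrakk>
      \<Longrightarrow> parcs G = join_arcs S X Y \<and> load (card S) (card X) (card Y) \<rho> = 1"
proof -
  interpret pair_graph G by fact
  have fin: "finite (pverts G)" by (rule pair_finite_verts)
  let ?z = "test_weight S X Y \<rho>" and ?N = "\<lambda>v. {w. (v, w) \<in> join_arcs S X Y}"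
  let ?L = "load (card S) (card X) (card Y) \<rho>"
  have N: "nbrs G v \<subseteq> ?N v" for v using sub by (auto simp: nbrs_def)
  have "?N v \<subseteq> pverts G" for v using V by (auto simp: join_arcs_def partitions_def)
  then have finN: "finite (?N v)" for v using fin finite_subset by blast
  have le: "sum ?z (nbrs G v) \<le> sum ?z (?N v)" for v
    by (rule sum_mono2[OF finN N less_imp_le[OF test_weight_pos[OF \<rho>]]])
  have full: "sum ?z (?N v) = \<rho> * ?z v - (\<rho> + 1) * (1 - ?L)" if "v \<in> pverts G" for v
    by (rule test_weight_neighbour_sum[OF V fin \<rho> that])
  have slack: "(\<rho> + 1) * (1 - ?L) \<ge> 0" using \<rho> load by simp
  have super: "sum ?z (nbrs G v) \<le> \<rho> * ?z v" if "v \<in> pverts G" for v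
    using le[of v] full[OF that] slack by linarith
  obtain c where c: "c \<in> spectrum (adjacency_matrix G)"
    "norm c = spectral_radius (adjacency_matrix G)"
    using spectral_radius_attained[OF fin ne] by blast
  show "spectral_radius (adjacency_matrix G) \<le> \<rho>"
    using supersolution_bounds_eigenvalues[OF G _ super c(1)] test_weight_pos[OF \<rho>] c(2) by metis
  assume eq: "spectral_radius (adjacency_matrix G) = \<rho>"
    and conn: "Digraph_Component.connected (with_proj G)"
  have tight: "sum ?z (nbrs G v) = \<rho> * ?z v" if "v \<in> pverts G" for v
    using supersolution_tight[OF G _ super c(1) _ conn that] test_weight_pos[OF \<rho>] c(2) eq by metis
  have "?L = 1"
  proof -
    obtain v where "v \<in> pverts G" using ne by blast
    then have "(\<rho> + 1) * (1 - ?L) = 0" using tight[of v] full[of v] le[of v] slack by linarith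
    then show ?thesis using \<rho> by simp
  qed
  moreover have "(v, w) \<in> parcs G" if vw: "(v, w) \<in> join_arcs S X Y" for v w
  proof (rule ccontr)
    assume no: "(v, w) \<notin> parcs G"
    have v: "v \<in> pverts G" using vw V by (auto simp: join_arcs_def partitions_def)
    have "sum ?z (nbrs G v) < sum ?z (?N v)"
      by (rule sum_strict_mono2[OF finN N _ test_weight_pos[OF \<rho>] less_imp_le[OF test_weight_pos[OF \<rho>]],
            of w]) (use vw no in \<open>simp add: nbrs_def\<close>)
    then show False using tight[OF v] full[OF v] slack by linarith
  qed
  ultimately show "parcs G = join_arcs S X Y \<and> ?L = 1" using sub by auto
qed

lemma join_spectral_radius:
  assumes G: "pair_graph G" and ne: "pverts G \<noteq> {}"
    and V: "partitions (pverts G) S X Y" and full: "parcs G = join_arcs S X Y"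
    and \<rho>: "\<rho> > 0" and load: "load (card S) (card X) (card Y) \<rho> = 1"
  shows "spectral_radius (adjacency_matrix G) = \<rho>"
proof (rule antisym)
  show "spectral_radius (adjacency_matrix G) \<le> \<rho>"
    using subgraph_of_join_spectral_radius(1)[OF G ne V _ \<rho>] full load by simp
  have fin: "finite (pverts G)" using G by (simp add: pair_graph_def pair_digraph_def pair_fin_digraph.pair_finite_verts)
  obtain v where v: "v \<in> pverts G" using ne by blast
  have "complex_of_real \<rho> \<in> spectrum (adjacency_matrix G)"
  proof (rule real_eigenfunction[OF fin v])
    show "test_weight S X Y \<rho> v \<noteq> 0" using test_weight_pos[OF \<rho>, of S X Y v] by simp
    show "(\<Sum>w\<in>nbrs G v. test_weight S X Y \<rho> w) = \<rho> * test_weight S X Y \<rho> v"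
      if "v \<in> pverts G" for v
      using test_weight_neighbour_sum[OF V fin \<rho> that] load
      by (simp add: nbrs_join_arcs[OF V full])
  qed
  then show "\<rho> \<le> spectral_radius (adjacency_matrix G)"
    using norm_le_spectral_radius[OF fin ne] \<rho> by force
qed

section \<open>Balanced parts maximise the load\<close>

text \<open>
  With \<open>N = a + b\<close> one has
  \<open>a / (\<rho> + a) + b / (\<rho> + b) = 2 - \<rho> (2 \<rho> + N) / (\<rho>\<^sup>2 + \<rho> N + a b)\<close>, which is strictly increasing in \<open>a b\<close>,
  and among integers with a fixed sum the product is largest exactly when they differ by at most one.
\<close>

lemma load_balanced:
  fixes a b m m' k :: nat
  assumes sum: "a + b = m + m'" and bal: "m' = m \<or> m' = m + 1" and \<rho>: "\<rho> > 0"
  shows "load k a b \<rho> \<le> load k m m' \<rho>"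
    and "load k a b \<rho> = load k m m' \<rho> \<Longrightarrow> (a = m \<and> b = m') \<or> (a = m' \<and> b = m)"
proof -
  define N where "N = real a + real b"
  have N: "N = real m + real m'" using sum by (simp add: N_def flip: of_nat_add)
  have den: "\<rho> * \<rho> + \<rho> * N + c > 0" if "c \<ge> 0" for c
    using \<rho> that by (simp add: N_def add_pos_nonneg)
  have expand: "load k c d \<rho> = real k / (\<rho> + 1) + 2
      - \<rho> * (2 * \<rho> + N) / (\<rho> * \<rho> + \<rho> * N + real (c * d))"
    if "real c + real d = N" for c d
  proof -
    have p: "\<rho> + real c \<noteq> 0" "\<rho> + real d \<noteq> 0" using \<rho> by auto
    have "real c / (\<rho> + real c) = 1 - \<rho> / (\<rho> + real c)"
      "real d / (\<rho> + real d) = 1 - \<rho> / (\<rho> + real d)" using p by (simp_all add: field_simps)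
    moreover have "\<rho> / (\<rho> + real c) + \<rho> / (\<rho> + real d)
        = \<rho> * (2 * \<rho> + N) / ((\<rho> + real c) * (\<rho> + real d))"
      unfolding add_frac_eq[OF p] by (simp add: that[symmetric] algebra_simps)
    ultimately have "real c / (\<rho> + real c) + real d / (\<rho> + real d)
        = 2 - \<rho> * (2 * \<rho> + N) / ((\<rho> + real c) * (\<rho> + real d))" by linarith
    also have "(\<rho> + real c) * (\<rho> + real d) = \<rho> * \<rho> + \<rho> * N + real (c * d)"
      by (simp add: that[symmetric] algebra_simps)
    finally show ?thesis by (simp add: load_def)
  qed
  have num: "\<rho> * (2 * \<rho> + N) > 0" using \<rho> by (simp add: N_def add_pos_nonneg)
  \<comment> \<open>for an integer \<open>t\<close>, both \<open>t * t\<close> and \<open>t * (t - 1)\<close> are nonnegative and vanish only in the balanced cases\<close>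
  define t where "t = int a - int m"
  have a: "int a = int m + t" and b: "int b = int m' - t" using sum by (auto simp: t_def)
  have prod: "int (m * m') - int (a * b) = t * (t - (int m' - int m))"
    by (simp add: a b algebra_simps)
  have "t * (t - (int m' - int m)) \<ge> 0"
    using bal by (auto simp: zero_le_mult_iff)
  then have "int (a * b) \<le> int (m * m')" using prod by linarith
  then have le: "real (a * b) \<le> real (m * m')" by linarith
  show "load k a b \<rho> \<le> load k m m' \<rho>"
    unfolding expand[OF N_def[symmetric]] expand[OF N[symmetric]]
    using divide_left_mono[OF add_left_mono[OF le], of "\<rho> * (2 * \<rho> + N)" "\<rho> * \<rho> + \<rho> * N"]
      num den by (simp add: less_imp_le)
  assume eq: "load k a b \<rho> = load k m m' \<rho>"
  have "\<rho> * (2 * \<rho> + N) / (\<rho> * \<rho> + \<rho> * N + real (a * b))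
      = \<rho> * (2 * \<rho> + N) / (\<rho> * \<rho> + \<rho> * N + real (m * m'))"
    using eq unfolding expand[OF N_def[symmetric]] expand[OF N[symmetric]] by simp
  then have "real (a * b) = real (m * m')"
    using num den[of "real (a * b)"] den[of "real (m * m')"] by (auto simp: frac_eq_eq)
  then have "int (a * b) = int (m * m')" by linarith
  then have "t = 0 \<or> t = int m' - int m" using prod by simp
  then show "(a = m \<and> b = m') \<or> (a = m' \<and> b = m)" using a b by auto
qed

text \<open>
  At \<open>0\<close> the load is \<open>k + 2\<close>, and at \<open>k + a + b\<close> it is below \<open>1\<close>.
\<close>

lemma load_root_exists:
  assumes "k \<ge> 1" "a \<ge> 1" "b \<ge> 1"
  obtains \<rho> where "\<rho> > 0" "load k a b \<rho> = 1"
proof -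
  let ?M = "real k + real a + real b"
  have "\<exists>\<rho>. 0 \<le> \<rho> \<and> \<rho> \<le> ?M \<and> load k a b \<rho> = 1"
  proof (rule IVT2')
    show "1 \<le> load k a b 0" using assms by (simp add: load_def)
    have "real a / (?M + real a) \<le> real a / (?M + 1)" "real b / (?M + real b) \<le> real b / (?M + 1)"
      using assms by (intro divide_left_mono mult_pos_pos add_nonneg_pos; simp)+
    then have "load k a b ?M \<le> ?M / (?M + 1)" by (simp add: load_def add_divide_distrib)
    also have "\<dots> \<le> 1" using assms by simp
    finally show "load k a b ?M \<le> 1" .
    show "continuous_on {0..?M} (load k a b)"
      unfolding load_def using assms by (intro continuous_intros) (auto simp: add_eq_0_iff)
  qed simp
  then obtain \<rho> where \<rho>: "0 \<le> \<rho>" "load k a b \<rho> = 1" by blast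
  have "\<rho> \<noteq> 0" using \<rho>(2) assms by (auto simp: load_def)
  then show ?thesis using \<rho> that by force
qed

section \<open>Isomorphisms\<close>

text \<open>
  For graphs given by pairs of vertices the arc part of a library isomorphism is determined by
  its vertex part.
\<close>

lemma digraph_iso_iff:
  assumes "pair_wf_digraph G"
  shows "digraph_iso (with_proj G) (with_proj H) \<longleftrightarrow>
    (\<exists>f. inj_on f (pverts G) \<and> pverts H = f ` pverts G \<and> parcs H = map_prod f f ` parcs G)"
    (is "?L \<longleftrightarrow> ?R")
proof
  interpret pair_wf_digraph G by fact
  assume ?L
  then obtain h where h: "pre_digraph.digraph_isomorphism (with_proj G) h"
    "with_proj H = app_iso h (with_proj G)" by (auto simp: digraph_iso_def)
  let ?f = "iso_verts h"
  have "verts (with_proj H) = ?f ` pverts G" "arcs (with_proj H) = iso_arcs h ` parcs G"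
    "tail (with_proj H) = iso_tail h" "head (with_proj H) = iso_head h" by (simp_all add: h(2))
  then have H: "pverts H = ?f ` pverts G" "parcs H = iso_arcs h ` parcs G"
    "iso_tail h = fst" "iso_head h = snd" by simp_all
  have "iso_arcs h e = map_prod ?f ?f e" if "e \<in> parcs G" for e
    using h(1) that unfolding pre_digraph.digraph_isomorphism_def H(3,4)
    by (auto simp: prod_eq_iff)
  then have "parcs H = map_prod ?f ?f ` parcs G" unfolding H(2) by (intro image_cong) auto
  moreover have "inj_on ?f (pverts G)"
    using h(1) by (simp add: pre_digraph.digraph_isomorphism_def)
  ultimately show ?R using H(1) by blast
next
  interpret pair_wf_digraph G by fact
  assume ?R
  then obtain f where f: "inj_on f (pverts G)" "pverts H = f ` pverts G"
    "parcs H = map_prod f f ` parcs G" by blast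
  define h where "h = \<lparr>iso_verts = f, iso_arcs = map_prod f f, iso_head = snd, iso_tail = fst\<rparr>"
  have "parcs G \<subseteq> pverts G \<times> pverts G" using wellformed' by auto
  then have "inj_on (map_prod f f) (parcs G)"
    using map_prod_inj_on[OF f(1) f(1)] inj_on_subset by blast
  then have "pre_digraph.digraph_isomorphism (with_proj G) h"
    using f(1) wf_digraph_axioms by (simp add: pre_digraph.digraph_isomorphism_def h_def)
  moreover have "with_proj H = app_iso h (with_proj G)"
    using f by (simp add: app_iso_def h_def with_proj_def)
  ultimately show ?L by (auto simp: digraph_iso_def)
qed

lemma digraph_iso_spectrum:
  assumes G: "pair_graph G" and iso: "digraph_iso (with_proj G) (with_proj H)"
  shows "spectrum (adjacency_matrix G) = spectrum (adjacency_matrix H)"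
proof -
  interpret pair_graph G by fact
  obtain f where f: "inj_on f (pverts G)" "pverts H = f ` pverts G"
    "parcs H = map_prod f f ` parcs G"
    using iso unfolding digraph_iso_iff[OF pair_wf_digraph_axioms] by blast
  obtain vs where vs: "distinct vs" "set vs = pverts G"
    using finite_distinct_list[OF pair_finite_verts] by auto
  have ws: "distinct (map f vs)" "set (map f vs) = pverts H"
    using vs f by (auto simp: distinct_map)
  have arc: "(f v, f w) \<in> parcs H \<longleftrightarrow> (v, w) \<in> parcs G" if "v \<in> pverts G" "w \<in> pverts G" for v w
  proof
    assume "(f v, f w) \<in> parcs H"
    then obtain v' w' where e: "(v', w') \<in> parcs G" "f v = f v'" "f w = f w'"
      unfolding f(3) by auto
    then have "v = v'" "w = w'" using inj_onD[OF f(1)] that wellformed' by blast+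
    then show "(v, w) \<in> parcs G" using e(1) by simp
  qed (auto simp: f(3))
  have "adjacency_matrix_wrt vs G = adjacency_matrix_wrt (map f vs) H"
    unfolding adjacency_matrix_wrt_def
    by (rule eq_matI) (simp_all add: arc[OF nth_mem[of _ vs, unfolded vs(2)] nth_mem[of _ vs, unfolded vs(2)]])
  then show ?thesis using spectrum_adjacency_matrix[OF vs] spectrum_adjacency_matrix[OF ws] by simp
qed

text \<open>
  A join is determined up to isomorphism by the three part sizes: glue bijections between
  corresponding parts.
\<close>

lemma join_graphs_iso:
  assumes wf: "pair_wf_digraph G" and fin: "finite (pverts G)" "finite (pverts H)"
    and V: "partitions (pverts G) S X Y" and full: "parcs G = join_arcs S X Y"
    and V': "partitions (pverts H) S' X' Y'" and full': "parcs H = join_arcs S' X' Y'"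
    and card: "card S = card S'" "card X = card X'" "card Y = card Y'"
  shows "digraph_iso (with_proj G) (with_proj H)"
proof -
  note parts = V[unfolded partitions_def] V'[unfolded partitions_def]
  have fins: "finite S" "finite X" "finite Y" "finite S'" "finite X'" "finite Y'"
    using parts fin by auto
  obtain f where f: "bij_betw f S S'" using finite_same_card_bij[OF fins(1,4) card(1)] by blast
  obtain g where g: "bij_betw g X X'" using finite_same_card_bij[OF fins(2,5) card(2)] by blast
  obtain h where h: "bij_betw h Y Y'" using finite_same_card_bij[OF fins(3,6) card(3)] by blast
  define F where "F v = (if v \<in> S then f v else if v \<in> X then g v else h v)" for v
  have bS: "bij_betw F S S'" using f by (rule bij_betw_cong[THEN iffD1, rotated]) (simp add: F_def)
  have bX: "bij_betw F X X'"
    using g by (rule bij_betw_cong[THEN iffD1, rotated]) (use parts in \<open>auto simp: F_def\<close>)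
  have bY: "bij_betw F Y Y'"
    using h by (rule bij_betw_cong[THEN iffD1, rotated]) (use parts in \<open>auto simp: F_def\<close>)
  have bSX: "bij_betw F (S \<union> X) (S' \<union> X')" using bS bX parts by (intro bij_betw_combine) auto
  have b: "bij_betw F (pverts G) (pverts H)"
    using bij_betw_combine[OF bSX bY] parts by (simp add: Int_Un_distrib2)
  have inj: "inj_on F (pverts G)" and img: "pverts H = F ` pverts G"
    using b by (auto simp: bij_betw_def)
  have mem: "F v \<in> X' \<longleftrightarrow> v \<in> X" "F v \<in> Y' \<longleftrightarrow> v \<in> Y" if "v \<in> pverts G" for v
    using that parts bS bX bY by (auto simp: bij_betw_def)
  have arc: "(F v, F w) \<in> join_arcs S' X' Y' \<longleftrightarrow> (v, w) \<in> join_arcs S X Y"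
    if "v \<in> pverts G" "w \<in> pverts G" for v w
  proof -
    have e: "F v = F w \<longleftrightarrow> v = w" using inj_on_eq_iff[OF inj] that by blast
    have m: "F v \<in> S' \<union> X' \<union> Y'" "F w \<in> S' \<union> X' \<union> Y'" using img that parts by auto
    have m': "v \<in> S \<union> X \<union> Y" "w \<in> S \<union> X \<union> Y" using that parts by auto
    show ?thesis unfolding join_arcs_def using e m m' mem[OF that(1)] mem[OF that(2)] by auto
  qed
  have "parcs H = map_prod F F ` parcs G"
  proof (intro Set.set_eqI iffI)
    fix e assume e: "e \<in> parcs H"
    then obtain x y where xy: "e = (x, y)" "x \<in> pverts H" "y \<in> pverts H"
      using parts unfolding full' join_arcs_def by auto
    then obtain v w where "x = F v" "y = F w" "v \<in> pverts G" "w \<in> pverts G"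
      unfolding img by auto
    then show "e \<in> map_prod F F ` parcs G"
      using e arc[of v w] xy unfolding full full' by force
  next
    fix e assume "e \<in> map_prod F F ` parcs G"
    then obtain v w where vw: "e = (F v, F w)" "(v, w) \<in> parcs G" by auto
    then have "v \<in> pverts G" "w \<in> pverts G" using parts unfolding full join_arcs_def by auto
    then show "e \<in> parcs H" using arc[of v w] vw unfolding full full' by simp
  qed
  then show ?thesis unfolding digraph_iso_iff[OF wf] using inj img by blast
qed

section \<open>Graphs of bounded vertex bipartiteness\<close>

text \<open>
  A minimal deleted set can be enlarged to have exactly \<open>k\<close> vertices, because an induced subgraph of a
  bipartite graph is bipartite.
\<close>

lemma Sigma_class_split:
  assumes G: "G \<in> Sigma_class k n" and kn: "k \<le> n"
  obtains S X Y where "partitions (pverts G) S X Y" "card S = k" "parcs G \<subseteq> join_arcs S X Y"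
proof -
  have pg: "pair_graph G" and card: "card (pverts G) = n" and vb: "vertex_bipartiteness G \<le> k"
    using G by (auto simp: Sigma_class_def)
  interpret pair_graph G by fact
  let ?P = "\<lambda>m. \<exists>S. S \<subseteq> pverts G \<and> card S = m \<and> bipartite (delete_verts G S)"
  have "parcs (delete_verts G (pverts G)) = {}"
    using wellformed' by (auto simp: delete_verts_def)
  then have "bipartite (delete_verts G (pverts G))"
    by (auto simp: bipartite_def delete_verts_def)
  then have "?P n" using card by blast
  then have "?P (vertex_bipartiteness G)" unfolding vertex_bipartiteness_def by (rule LeastI)
  then obtain S0 where S0: "S0 \<subseteq> pverts G" "card S0 \<le> k" "bipartite (delete_verts G S0)"
    using vb by auto
  then obtain X Y where XY: "X \<union> Y = pverts G - S0" "X \<inter> Y = {}"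
    "parcs (delete_verts G S0) \<subseteq> X \<times> Y \<union> Y \<times> X"
    by (auto simp: bipartite_def delete_verts_def)
  obtain S where S: "S0 \<subseteq> S" "S \<subseteq> pverts G" "card S = k"
    using exists_subset_between[of S0 k "pverts G"] S0 kn card pair_finite_verts by auto
  have "partitions (pverts G) S (X - S) (Y - S)"
    using XY S by (auto simp: partitions_def)
  moreover have "parcs G \<subseteq> join_arcs S (X - S) (Y - S)"
  proof
    fix e assume e: "e \<in> parcs G"
    obtain v w where vw: "e = (v, w)" by (cases e)
    have VW: "v \<in> pverts G" "w \<in> pverts G" "v \<noteq> w"
      using e wellformed' no_loops' unfolding vw by blast+
    have mem: "x \<in> S \<union> (X - S) \<union> (Y - S)" if "x \<in> pverts G" for x
      using that XY(1) S(1) by blast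
    have "e \<notin> (X - S) \<times> (X - S)" "e \<notin> (Y - S) \<times> (Y - S)"
      using e XY S unfolding vw by (auto simp: delete_verts_def)
    then show "e \<in> join_arcs S (X - S) (Y - S)"
      using VW mem unfolding vw join_arcs_def by blast
  qed
  ultimately show ?thesis using S(3) that by blast
qed

text \<open>
  A vertex of \<open>S\<close> is adjacent to all others, which makes the join connected; deleting \<open>S\<close> leaves the
  bipartition into \<open>X\<close> and \<open>Y\<close>.
\<close>

lemma join_graph_in_Sigma_class:
  assumes V: "partitions (pverts G) S X Y" and full: "parcs G = join_arcs S X Y"
    and fin: "finite (pverts G)" and ne: "S \<noteq> {}"
  shows "G \<in> Sigma_class (card S) (card (pverts G))"
proof -
  have sub: "parcs G \<subseteq> pverts G \<times> pverts G"
    using V unfolding full by (auto simp: join_arcs_def partitions_def)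
  have sym: "(w, v) \<in> parcs G" if "(v, w) \<in> parcs G" for v w
    using that unfolding full by (auto simp: join_arcs_def)
  have "pair_graph G"
  proof
    show "finite (parcs G)" using finite_subset[OF sub] fin by simp
    show "symmetric (with_proj G)" using sym by (auto simp: symmetric_def intro: symI)
    show "fst e \<noteq> snd e" if "e \<in> parcs G" for e
      using that unfolding full by (auto simp: join_arcs_def)
  qed (use sub fin in auto)
  moreover have "Digraph_Component.connected (with_proj G)"
    unfolding Digraph_Component.connected_conv
  proof (intro conjI ballI)
    obtain s where s: "s \<in> S" using ne by blast
    show "verts (with_proj G) \<noteq> {}" using s V by (auto simp: partitions_def)
    fix u v assume uv: "u \<in> verts (with_proj G)" "v \<in> verts (with_proj G)"
    let ?R = "rtrancl_on (verts (with_proj G)) ((arcs_ends (with_proj G))\<^sup>s)"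
    have sV: "s \<in> pverts G" using s V by (auto simp: partitions_def)
    have adj: "(u, s) \<in> parcs G" "(s, u) \<in> parcs G" if "u \<in> pverts G" "u \<noteq> s" for u
      using that s V unfolding full by (auto simp: join_arcs_def partitions_def)
    have to: "(u, s) \<in> ?R \<and> (s, u) \<in> ?R" if "u \<in> pverts G" for u
    proof (cases "u = s")
      case True
      then show ?thesis using sV by simp
    next
      case False
      then have "(u, s) \<in> (parcs G)\<^sup>s" "(s, u) \<in> (parcs G)\<^sup>s"
        using adj[OF that] by (auto simp: symcl_def)
      then show ?thesis using that sV by (auto intro: rtrancl_on_into_rtrancl_on)
    qed
    show "(u, v) \<in> ?R"
      using to[of u] to[of v] uv by (auto intro: rtrancl_on_trans)
  qed
  moreover have "vertex_bipartiteness G \<le> card S"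
    unfolding vertex_bipartiteness_def
  proof (rule Least_le, intro exI[of _ S] conjI refl)
    show "S \<subseteq> pverts G" using V by (auto simp: partitions_def)
    show "bipartite (delete_verts G S)"
      unfolding bipartite_def
      by (rule exI[of _ X], rule exI[of _ Y])
        (use V full in \<open>auto simp: partitions_def delete_verts_def join_arcs_def\<close>)
  qed
  ultimately show ?thesis by (simp add: Sigma_class_def)
qed

section \<open>The extremal graph\<close>

definition split_join :: "nat \<Rightarrow> nat \<Rightarrow> nat \<Rightarrow> (nat + nat + nat) pair_pre_digraph" where
  "split_join k a b = graph_join (complete_graph k)
     (graph_join (graph_complement (complete_graph a)) (graph_complement (complete_graph b)))"

lemma split_join_parts:
  fixes k a b
  defines "S \<equiv> Inl ` {..<k} :: (nat + nat + nat) set"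
    and "X \<equiv> (Inr \<circ> Inl) ` {..<a}" and "Y \<equiv> (Inr \<circ> Inr) ` {..<b}"
  shows "partitions (pverts (split_join k a b)) S X Y"
    and "parcs (split_join k a b) = join_arcs S X Y"
    and "card S = k" "card X = a" "card Y = b"
proof -
  let ?D = "\<lambda>m. graph_complement (complete_graph m)"
  have D: "pverts (?D m) = {..<m}" "parcs (?D m) = {}" for m
    by (auto simp: graph_complement_def complete_graph_def)
  have K: "pverts (complete_graph k) = {..<k}"
    "(u, v) \<in> parcs (complete_graph k) \<longleftrightarrow> u < k \<and> v < k \<and> u \<noteq> v" for u v
    by (auto simp: complete_graph_def)
  show "partitions (pverts (split_join k a b)) S X Y"
    by (auto simp: partitions_def split_join_def graph_join_def D K S_def X_def Y_def)
  show "parcs (split_join k a b) = join_arcs S X Y"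
  proof (intro Set.set_eqI)
    fix e :: "(nat + nat + nat) \<times> (nat + nat + nat)"
    obtain v w where e: "e = (v, w)" by (cases e)
    show "e \<in> parcs (split_join k a b) \<longleftrightarrow> e \<in> join_arcs S X Y"
      unfolding e
      by (cases v; cases w; (cases "projr v")?; (cases "projr w")?)
        (auto simp: join_arcs_def split_join_def graph_join_def D K S_def X_def Y_def)
  qed
  show "card S = k" "card X = a" "card Y = b"
    unfolding S_def X_def Y_def by (subst card_image; auto simp: inj_on_def)+
qed

lemma split_join_basics:
  shows split_join_Sigma_class: "k \<ge> 1 \<Longrightarrow> split_join k a b \<in> Sigma_class k (k + a + b)"
    and finite_split_join: "finite (pverts (split_join k a b))"
    and card_split_join: "card (pverts (split_join k a b)) = k + a + b"
proof -
  note P = split_join_parts(1,2)[of k a b] and C = split_join_parts(3-5)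
  show fin: "finite (pverts (split_join k a b))"
    using P(1) by (simp add: partitions_def)
  show card: "card (pverts (split_join k a b)) = k + a + b"
    using P(1) fin C by (simp add: partitions_def card_Un_disjoint Int_Un_distrib2)
  assume "k \<ge> 1"
  then show "split_join k a b \<in> Sigma_class k (k + a + b)"
    using join_graph_in_Sigma_class[OF P fin] card C(1) by (auto simp: lessThan_empty_iff)
qed

lemma split_join_pair_graph: "k \<ge> 1 \<Longrightarrow> pair_graph (split_join k a b)"
  using split_join_Sigma_class by (auto simp: Sigma_class_def)

lemma split_join_spectral_radius:
  assumes "k \<ge> 1" "\<rho> > 0" "load k a b \<rho> = 1"
  shows "spectral_radius (adjacency_matrix (split_join k a b)) = \<rho>"
proof (rule join_spectral_radius[OF split_join_pair_graph[OF assms(1)] _ split_join_parts(1,2) assms(2)])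
  show "pverts (split_join k a b) \<noteq> {}" using card_split_join[of k a b] assms(1) by auto
qed (simp only: split_join_parts assms(3))

text \<open>
  The value \<open>\<rho>\<close> belongs to the balanced join, whereas the test weight comes from the parts of \<open>G\<close>;
  \<open>load_balanced\<close> links the two. When the parts of \<open>G\<close> have the balanced sizes in the opposite order,
  exchanging \<open>X\<close> and \<open>Y\<close> leaves the join unchanged.
\<close>

lemma split_join_extremal:
  assumes k: "k \<ge> 1" and bal: "m' = m \<or> m' = m + 1"
    and \<rho>: "\<rho> > 0" and load: "load k m m' \<rho> = 1"
    and G: "G \<in> Sigma_class k (k + m + m')"
  shows "spectral_radius (adjacency_matrix G) \<le> spectral_radius (adjacency_matrix (split_join k m m'))"
    and "spectral_radius (adjacency_matrix (split_join k m m')) = spectral_radius (adjacency_matrix G)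
      \<longleftrightarrow> digraph_iso (with_proj G) (with_proj (split_join k m m'))"
proof -
  have pg: "pair_graph G" and conn: "Digraph_Component.connected (with_proj G)"
    and n: "card (pverts G) = k + m + m'" using G by (auto simp: Sigma_class_def)
  interpret pair_graph G by fact
  note sr = split_join_spectral_radius[OF k \<rho> load]
  obtain S X Y where V: "partitions (pverts G) S X Y" and S: "card S = k"
    and sub: "parcs G \<subseteq> join_arcs S X Y" using Sigma_class_split[OF G] by auto
  have fins: "finite S" "finite X" "finite Y"
    using V pair_finite_verts by (auto simp: partitions_def)
  have ne: "pverts G \<noteq> {}" using n k by auto
  have XY: "card X + card Y = m + m'"
    using V fins n S by (simp add: partitions_def card_Un_disjoint Int_Un_distrib2)
  note bal_le = load_balanced[OF XY bal \<rho>, of k]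
  have le1: "load (card S) (card X) (card Y) \<rho> \<le> 1" using bal_le(1) load S by simp
  note bound = subgraph_of_join_spectral_radius[OF pg ne V sub \<rho> le1]
  show "spectral_radius (adjacency_matrix G) \<le> spectral_radius (adjacency_matrix (split_join k m m'))"
    using bound(1) sr by simp
  show "spectral_radius (adjacency_matrix (split_join k m m')) = spectral_radius (adjacency_matrix G)
      \<longleftrightarrow> digraph_iso (with_proj G) (with_proj (split_join k m m'))"
  proof
    assume "spectral_radius (adjacency_matrix (split_join k m m')) = spectral_radius (adjacency_matrix G)"
    then have full: "parcs G = join_arcs S X Y" and "load (card S) (card X) (card Y) \<rho> = 1"
      using bound(2)[OF _ conn] sr by auto
    then consider "card X = m" "card Y = m'" | "card X = m'" "card Y = m"
      using bal_le(2) load S by auto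
    then show "digraph_iso (with_proj G) (with_proj (split_join k m m'))"
    proof cases
      case 1
      then show ?thesis
        by (intro join_graphs_iso[OF pair_wf_digraph_axioms pair_finite_verts finite_split_join V full
              split_join_parts(1,2)]) (simp_all only: S 1 split_join_parts)
    next
      case 2
      have V': "partitions (pverts G) S Y X" using V by (auto simp: partitions_def)
      have full': "parcs G = join_arcs S Y X" unfolding full by (auto simp: join_arcs_def)
      show ?thesis
        by (intro join_graphs_iso[OF pair_wf_digraph_axioms pair_finite_verts finite_split_join V' full'
              split_join_parts(1,2)]) (simp_all only: S 2 split_join_parts)
    qed
  next
    assume "digraph_iso (with_proj G) (with_proj (split_join k m m'))"
    then show "spectral_radius (adjacency_matrix (split_join k m m')) = spectral_radius (adjacency_matrix G)"
      using digraph_iso_spectrum[OF pg] by (metis spectral_radius_def)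
  qed
qed

section \<open>The closed formula and the quotient matrix\<close>

lemma load_equal_parts_eq_1_iff:
  assumes "\<rho> > 0"
  shows "load k m m \<rho> = 1 \<longleftrightarrow> \<rho> ^ 2 - (real k - 1 + real m) * \<rho> - real m * (real k + 1) = 0"
proof -
  have nz: "\<rho> + 1 \<noteq> 0" "\<rho> + real m \<noteq> 0" using assms by auto
  have "load k m m \<rho> = real k / (\<rho> + 1) + (2 * real m) / (\<rho> + real m)"
    by (simp add: load_def)
  also have "\<dots> = (real k * (\<rho> + real m) + 2 * real m * (\<rho> + 1)) / ((\<rho> + 1) * (\<rho> + real m))"
    by (rule add_frac_eq[OF nz])
  finally have "load k m m \<rho> = 1 \<longleftrightarrow>
      real k * (\<rho> + real m) + 2 * real m * (\<rho> + 1) = (\<rho> + 1) * (\<rho> + real m)"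
    using nz by (auto simp: divide_eq_1_iff)
  then show ?thesis by (simp add: algebra_simps power2_eq_square) linarith
qed

lemma eigenvalue_3x3_iff:
  fixes \<mu> :: real
  shows "eigenvalue (mat_of_rows_list 3 [[a, b, c], [d, e, f], [g, h, i]]) \<mu> \<longleftrightarrow>
    (\<exists>x y z. (x \<noteq> 0 \<or> y \<noteq> 0 \<or> z \<noteq> 0) \<and> a * x + b * y + c * z = \<mu> * x \<and>
       d * x + e * y + f * z = \<mu> * y \<and> g * x + h * y + i * z = \<mu> * z)" (is "_ = ?R")
proof -
  let ?A = "mat_of_rows_list 3 [[a, b, c], [d, e, f], [g, h, i]]"
  have three: "(\<forall>i<3. P i) \<longleftrightarrow> P 0 \<and> P 1 \<and> P 2" for P :: "nat \<Rightarrow> bool"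
    by (auto simp: numeral_3_eq_3 less_Suc_eq numeral_2_eq_2)
  have dim: "dim_row ?A = 3" by (simp add: mat_of_rows_list_def)
  have vec3: "eigenvector ?A v \<mu> \<longleftrightarrow> (v $ 0 \<noteq> 0 \<or> v $ 1 \<noteq> 0 \<or> v $ 2 \<noteq> 0) \<and>
      a * v $ 0 + b * v $ 1 + c * v $ 2 = \<mu> * v $ 0 \<and>
      d * v $ 0 + e * v $ 1 + f * v $ 2 = \<mu> * v $ 1 \<and>
      g * v $ 0 + h * v $ 1 + i * v $ 2 = \<mu> * v $ 2" if v: "v \<in> carrier_vec 3" for v
  proof -
    have "v = 0\<^sub>v 3 \<longleftrightarrow> (\<forall>i<3. v $ i = 0)" using v by (auto intro: eq_vecI)
    moreover have "?A *\<^sub>v v = \<mu> \<cdot>\<^sub>v v \<longleftrightarrow> (\<forall>i<3. (?A *\<^sub>v v) $ i = \<mu> * v $ i)"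
      using v by (auto simp: vec_eq_iff mat_of_rows_list_def)
    moreover have "(?A *\<^sub>v v) $ 0 = a * v $ 0 + b * v $ 1 + c * v $ 2"
      "(?A *\<^sub>v v) $ 1 = d * v $ 0 + e * v $ 1 + f * v $ 2"
      "(?A *\<^sub>v v) $ 2 = g * v $ 0 + h * v $ 1 + i * v $ 2"
      using v by (simp_all add: mat_of_rows_list_def scalar_prod_def numeral_3_eq_3 numeral_2_eq_2)
    ultimately show ?thesis
      using v unfolding three by (auto simp: eigenvector_def dim)
  qed
  show ?thesis
  proof
    assume "eigenvalue ?A \<mu>"
    then obtain v where "eigenvector ?A v \<mu>" by (auto simp: eigenvalue_def)
    moreover from this have "v \<in> carrier_vec 3" by (simp add: eigenvector_def dim)
    ultimately show ?R using vec3[of v] by blast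
  next
    assume ?R
    then obtain x y z where "(x \<noteq> 0 \<or> y \<noteq> 0 \<or> z \<noteq> 0) \<and> a * x + b * y + c * z = \<mu> * x \<and>
       d * x + e * y + f * z = \<mu> * y \<and> g * x + h * y + i * z = \<mu> * z" by blast
    then have "eigenvector ?A (vec 3 (\<lambda>j. [x, y, z] ! j)) \<mu>" by (subst vec3) simp_all
    then show "eigenvalue ?A \<mu>" by (auto simp: eigenvalue_def)
  qed
qed

text \<open>
  The hypotheses say that \<open>(p, q, r)\<close> is an eigenvector of the quotient matrix for the partition into
  the three parts. Every vertex of a part sees the same number of vertices of each part, so the
  function that is constant on parts with these values is an eigenvector of the graph.
\<close>

lemma quotient_eigenvalue_lifts:
  fixes p q r \<mu> :: real
  assumes k: "k \<ge> 1" and a: "a \<ge> 1" and b: "b \<ge> 1" and nz: "p \<noteq> 0 \<or> q \<noteq> 0 \<or> r \<noteq> 0"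
    and S: "(real k - 1) * p + real a * q + real b * r = \<mu> * p"
    and X: "real k * p + real b * r = \<mu> * q"
    and Y: "real k * p + real a * q = \<mu> * r"
  shows "\<mu> \<le> spectral_radius (adjacency_matrix (split_join k a b))"
proof -
  let ?G = "split_join k a b"
  let ?S = "Inl ` {..<k} :: (nat + nat + nat) set" and ?X = "(Inr \<circ> Inl) ` {..<a}"
    and ?Y = "(Inr \<circ> Inr) ` {..<b}"
  note V = split_join_parts(1)[of k a b] and full = split_join_parts(2)[of k a b]
    and C = split_join_parts(3)[of k] split_join_parts(4)[of a] split_join_parts(5)[of b]
  let ?u = "weight ?S ?X p q r"
  have pv: "pverts ?G = ?S \<union> ?X \<union> ?Y" using V by (simp add: partitions_def)
  have "\<exists>v \<in> pverts ?G. ?u v \<noteq> 0"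
  proof -
    have "?u (Inl 0) = p" "?u (Inr (Inl 0)) = q" "?u (Inr (Inr 0)) = r"
      using k a b by (auto simp: weight_def image_iff)
    moreover have "Inl 0 \<in> pverts ?G" "Inr (Inl 0) \<in> pverts ?G" "Inr (Inr 0) \<in> pverts ?G"
      using k a b by (auto simp: pv image_iff)
    ultimately show ?thesis using nz by metis
  qed
  then obtain v where v: "v \<in> pverts ?G" "?u v \<noteq> 0" by blast
  have "(\<Sum>w\<in>nbrs ?G v. ?u w) = \<mu> * ?u v" if v: "v \<in> pverts ?G" for v
  proof -
    note sums = join_neighbour_sum[OF V finite_split_join, of v p q r, unfolded C]
    consider "v \<in> ?S" | "v \<in> ?X" | "v \<in> ?Y" using v pv by blast
    then show ?thesis
    proof cases
      case 1
      then show ?thesis unfolding nbrs_join_arcs[OF V full] sums(1)[OF 1] by (simp add: weight_def S)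
    next
      case 2
      then have "v \<notin> ?S" by auto
      then show ?thesis unfolding nbrs_join_arcs[OF V full] sums(2)[OF 2] using 2 by (simp add: weight_def X)
    next
      case 3
      then have "v \<notin> ?S" "v \<notin> ?X" by auto
      then show ?thesis unfolding nbrs_join_arcs[OF V full] sums(3)[OF 3] by (simp add: weight_def Y)
    qed
  qed
  then have "complex_of_real \<mu> \<in> spectrum (adjacency_matrix ?G)"
    by (rule real_eigenfunction[where u = ?u, OF finite_split_join v])
  then have "norm (complex_of_real \<mu>) \<le> spectral_radius (adjacency_matrix ?G)"
    by (rule norm_le_spectral_radius[OF finite_split_join, rotated]) (use v in auto)
  then show ?thesis by simp
qed

text \<open>
  The test weight at a root of the load equation, read off on the three parts.
\<close>

lemma load_root_solves_quotient:
  assumes \<rho>: "\<rho> > 0" and load: "load k a b \<rho> = 1"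
  defines "q \<equiv> (\<rho> + 1) / (\<rho> + real a)" and "r \<equiv> (\<rho> + 1) / (\<rho> + real b)"
  shows "(real k - 1) + real a * q + real b * r = \<rho>"
    and "real k + real b * r = \<rho> * q" and "real k + real a * q = \<rho> * r"
proof -
  have nz: "\<rho> + 1 \<noteq> 0" "\<rho> + real a \<noteq> 0" "\<rho> + real b \<noteq> 0" using \<rho> by auto
  have k1: "(\<rho> + 1) * (real k / (\<rho> + 1)) = real k" using nz(1) by simp
  have "(\<rho> + 1) * load k a b \<rho> = real k + real a * q + real b * r"
    unfolding load_def q_def r_def distrib_left[of "\<rho> + 1"] k1
    by (simp only: times_divide_eq_right mult.commute)
  then have T: "real k + real a * q + real b * r = \<rho> + 1" using load by simp
  have "(\<rho> + real a) * q = \<rho> + 1" "(\<rho> + real b) * r = \<rho> + 1" using nz by (simp_all add: q_def r_def)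
  then show "(real k - 1) + real a * q + real b * r = \<rho>"
    "real k + real b * r = \<rho> * q" "real k + real a * q = \<rho> * r"
    using T by (simp_all add: algebra_simps)
qed

theorem theorem3p2:
  fixes n k :: nat
  assumes "1 \<le> k" and "k + 3 \<le> n"
  shows
    "(even (n - k) \<longrightarrow>
      (let Ghat = graph_join (complete_graph k)
             (graph_join (graph_complement (complete_graph ((n - k) div 2)))
                         (graph_complement (complete_graph ((n - k) div 2))))
       in Ghat \<in> Sigma_class k n \<and>
          (\<forall>G :: 'a pair_pre_digraph. G \<in> Sigma_class k n \<longrightarrow>
             spectral_radius (adjacency_matrix Ghat) \<ge> spectral_radius (adjacency_matrix G) \<and>
             (spectral_radius (adjacency_matrix Ghat) = spectral_radius (adjacency_matrix G)
                \<longleftrightarrow> digraph_iso (with_proj G) (with_proj Ghat))) \<and>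
          spectral_radius (adjacency_matrix Ghat) =
            (real n + real k - 2 +
              sqrt (- 7 * real k ^ 2 + 10 * real k * real n - 12 * real k
                    + real n ^ 2 + 4 * real n + 4)) / 4))
     \<and>
     (odd (n - k) \<longrightarrow>
      (let s = (n - k) div 2;
           Ghat = graph_join (complete_graph k)
             (graph_join (graph_complement (complete_graph ((n - k) div 2)))
                         (graph_complement (complete_graph ((n - k + 1) div 2))));
           Upsilon = mat_of_rows_list 3
             [[real k - 1, real s + 1, real s],
              [real k,     0,          real s],
              [real k,     real s + 1, 0     ]]
       in Ghat \<in> Sigma_class k n \<and>
          (\<forall>G :: 'a pair_pre_digraph. G \<in> Sigma_class k n \<longrightarrow>
             spectral_radius (adjacency_matrix Ghat) \<ge> spectral_radius (adjacency_matrix G) \<and>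
             (spectral_radius (adjacency_matrix Ghat) = spectral_radius (adjacency_matrix G)
                \<longleftrightarrow> digraph_iso (with_proj G) (with_proj Ghat))) \<and>
          eigenvalue Upsilon (spectral_radius (adjacency_matrix Ghat)) \<and>
          (\<forall>\<mu>. eigenvalue Upsilon \<mu> \<longrightarrow> \<mu> \<le> spectral_radius (adjacency_matrix Ghat))))"
proof (rule conjI; rule impI)
  define m where "m = (n - k) div 2"
  have m: "m \<ge> 1" using assms(2) by (simp add: m_def)
  {
    assume "even (n - k)"
    then have "2 * m = n - k" by (simp add: m_def)
    then have n: "n = k + m + m" using assms(2) by linarith
    define \<rho> where "\<rho> = (real n + real k - 2 +
              sqrt (- 7 * real k ^ 2 + 10 * real k * real n - 12 * real k
                    + real n ^ 2 + 4 * real n + 4)) / 4"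
    \<comment> \<open>\<open>\<rho>\<close> is the larger root of \<open>x\<^sup>2 - B x - m (k + 1)\<close>, whose discriminant is \<open>D\<close>\<close>
    define B where "B = real k - 1 + real m"
    define D where "D = B ^ 2 + 4 * (real m * (real k + 1))"
    have "sqrt (- 7 * real k ^ 2 + 10 * real k * real n - 12 * real k + real n ^ 2 + 4 * real n + 4)
        = sqrt (2 ^ 2 * D)"
      by (rule arg_cong[of _ _ sqrt]) (simp add: n D_def B_def power2_eq_square algebra_simps)
    also have "\<dots> = 2 * sqrt D" by (simp add: real_sqrt_mult)
    finally have \<rho>_eq: "\<rho> = (B + sqrt D) / 2" by (simp add: \<rho>_def n B_def)
    have B: "B > 0" using assms(1) m by (simp add: B_def)
    have D: "D \<ge> 0" by (simp add: D_def)
    have \<rho>: "\<rho> > 0" unfolding \<rho>_eq using add_pos_nonneg[OF B real_sqrt_ge_zero[OF D]] by simp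
    have sD: "sqrt D * sqrt D = D" using D by simp
    have "\<rho> ^ 2 - B * \<rho> - real m * (real k + 1) = (sqrt D * sqrt D - D) / 4"
      by (simp add: \<rho>_eq D_def power2_eq_square algebra_simps)
    then have load: "load k m m \<rho> = 1"
      unfolding load_equal_parts_eq_1_iff[OF \<rho>] B_def[symmetric] using sD by simp
    show "let Ghat = graph_join (complete_graph k)
             (graph_join (graph_complement (complete_graph ((n - k) div 2)))
                         (graph_complement (complete_graph ((n - k) div 2))))
       in Ghat \<in> Sigma_class k n \<and>
          (\<forall>G :: 'a pair_pre_digraph. G \<in> Sigma_class k n \<longrightarrow>
             spectral_radius (adjacency_matrix Ghat) \<ge> spectral_radius (adjacency_matrix G) \<and>
             (spectral_radius (adjacency_matrix Ghat) = spectral_radius (adjacency_matrix G)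
                \<longleftrightarrow> digraph_iso (with_proj G) (with_proj Ghat))) \<and>
          spectral_radius (adjacency_matrix Ghat) =
            (real n + real k - 2 +
              sqrt (- 7 * real k ^ 2 + 10 * real k * real n - 12 * real k
                    + real n ^ 2 + 4 * real n + 4)) / 4"
      unfolding Let_def m_def[symmetric] split_join_def[symmetric] \<rho>_def[symmetric]
      using split_join_Sigma_class[OF assms(1), of m m, folded n]
        split_join_extremal[OF assms(1) disjI1[OF refl] \<rho> load, folded n]
        split_join_spectral_radius[OF assms(1) \<rho> load]
      by blast
  next
    assume "odd (n - k)"
    then have n: "n = k + m + (m + 1)" and m': "(n - k + 1) div 2 = m + 1"
      using assms(2) by (auto simp: m_def elim!: oddE)
    have m1: "m + 1 \<ge> 1" by simp
    obtain \<rho> where \<rho>: "\<rho> > 0" and load: "load k m (m + 1) \<rho> = 1"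
      using load_root_exists[OF assms(1) m m1] by blast
    note sr = split_join_spectral_radius[OF assms(1) \<rho> load]
    let ?U = "mat_of_rows_list 3
             [[real k - 1, real m + 1, real m],
              [real k,     0,          real m],
              [real k,     real m + 1, 0     ]]"
    have "eigenvalue ?U (spectral_radius (adjacency_matrix (split_join k m (m + 1))))"
      unfolding sr eigenvalue_3x3_iff
      using load_root_solves_quotient[OF \<rho> load]
      \<comment> \<open>the second row of the matrix belongs to the part with \<open>m + 1\<close> vertices, the third to the one with \<open>m\<close>\<close>
      by (intro exI[of _ 1] exI[of _ "(\<rho> + 1) / (\<rho> + real (m + 1))"] exI[of _ "(\<rho> + 1) / (\<rho> + real m)"])
        (simp add: add.commute add.left_commute)
    moreover have "\<mu> \<le> spectral_radius (adjacency_matrix (split_join k m (m + 1)))"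
      if ev: "eigenvalue ?U \<mu>" for \<mu>
    proof -
      obtain x y z where "x \<noteq> 0 \<or> y \<noteq> 0 \<or> z \<noteq> 0"
        "(real k - 1) * x + (real m + 1) * y + real m * z = \<mu> * x"
        "real k * x + 0 * y + real m * z = \<mu> * y"
        "real k * x + (real m + 1) * y + 0 * z = \<mu> * z"
        using ev unfolding eigenvalue_3x3_iff by blast
      then show ?thesis
        by (intro quotient_eigenvalue_lifts[OF assms(1) m m1, of x z y]) (auto simp: algebra_simps)
    qed
    ultimately show "let s = (n - k) div 2;
           Ghat = graph_join (complete_graph k)
             (graph_join (graph_complement (complete_graph ((n - k) div 2)))
                         (graph_complement (complete_graph ((n - k + 1) div 2))));
           Upsilon = mat_of_rows_list 3
             [[real k - 1, real s + 1, real s],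
              [real k,     0,          real s],
              [real k,     real s + 1, 0     ]]
       in Ghat \<in> Sigma_class k n \<and>
          (\<forall>G :: 'a pair_pre_digraph. G \<in> Sigma_class k n \<longrightarrow>
             spectral_radius (adjacency_matrix Ghat) \<ge> spectral_radius (adjacency_matrix G) \<and>
             (spectral_radius (adjacency_matrix Ghat) = spectral_radius (adjacency_matrix G)
                \<longleftrightarrow> digraph_iso (with_proj G) (with_proj Ghat))) \<and>
          eigenvalue Upsilon (spectral_radius (adjacency_matrix Ghat)) \<and>
          (\<forall>\<mu>. eigenvalue Upsilon \<mu> \<longrightarrow> \<mu> \<le> spectral_radius (adjacency_matrix Ghat))"
      unfolding Let_def m' m_def[symmetric] split_join_def[symmetric]
      using split_join_Sigma_class[OF assms(1), of m "m + 1", folded n]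
        split_join_extremal[OF assms(1) disjI2[OF refl] \<rho> load, folded n]
      by blast
  }
qed

end
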